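(* Let $X$ be a $T_0$ space such that $\mathord{\downarrow}(K\cap A)$ is closed in $X$ for every $A\in\mathbf{KF}(X)$ and every compact saturated subset $K\in Q(X)$. If $\mathbf{KF}(X)$ endowed with the lower Vietoris topology is the well-filterification of $X$, then the $D$-completion of $X$ agrees with the well-filterification of $X$.
   Context: For a $T_0$ space $X$, the specialization order is $x\le y$ iff $x\in cl(\{y\})$; $\mathord{\downarrow}$ and $\mathord{\uparrow}$ refer to it. $\Gamma(X)$ is the set of closed subsets of $X$, and $Q(X)$ the set of compact saturated subsets (saturated means $K=\mathord{\uparrow}K$). A family $\mathfrak K\subseteq Q(X)$ is filtered if it is nonempty and any two members contain a common member. A nonempty set $A\subseteq X$ is a $KF$-set if there is a filtered family $\mathfrak K\subseteq Q(X)$ such that $cl(A)$ is minimal among the closed sets that intersect all members of $\mathfrak K$; $\mathbf{KF}(X)$ is the set of closed $KF$-sets. The lower Vietoris topology on a family of closed sets has as subbasis the sets $\diamondsuit U=\{A: A\cap U\neq\emptyset\}$, $U$ open in $X$. A space is well-filtered if for each filtered family $\mathcal C$ of compact saturated sets and each open $U$ with $\bigcap\mathcal C\subseteq U$ there is $K\in\mathcal C$ with $K\subseteq U$. A subset $A$ of a $T_0$ space $X$ is a $WD$-set if for every continuous $f:X\to Y$ into a well-filtered ($T_0$) space $Y$ there is a unique $y_A\in Y$ with $cl(f(A))=cl(\{y_A\})$; $\mathbf{WD}(X)$ is the set of closed $WD$-sets. The well-filterification (well-filtered reflection) of $X$ is $\mathbf{WD}(X)$ with the lower Vietoris topology and the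 map $x\mapsto\mathord{\downarrow}x=cl(\{x\})$. Thus the hypothesis on $\mathbf{KF}(X)$ says $\mathbf{KF}(X)=\mathbf{WD}(X)$. A monotone convergence space is a $T_0$ space in which the closure of every directed set (in the specialization order) is the closure of a unique point. A subset of a poset is $d$-closed if it contains the supremum (when it exists) of each of its directed subsets; $cl_d(B)$ is the smallest $d$-closed set containing $B$. A $D$-completion of $X$ is a monotone convergence space $Y$ with a topological embedding $j:X\to Y$ such that $cl_d(j(X))=Y$. It is unique up to homeomorphism; its standard form is the $d$-closure of $\{\mathord{\downarrow}x:x\in X\}$ in $(\Gamma(X),\subseteq)$ with the lower Vietoris topology, and it is contained in $\mathbf{WD}(X)$. "Agrees" means that this subset of $\Gamma(X)$ equals $\mathbf{WD}(X)$. *)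

theory Defs
  imports "HOL-Analysis.Abstract_Topological_Spaces"
begin

definition spec_le :: "'a topology \<Rightarrow> 'a \<Rightarrow> 'a \<Rightarrow> bool" where
  "spec_le X x y \<longleftrightarrow> y \<in> topspace X \<and> x \<in> X closure_of {y}"

definition downset :: "'a topology \<Rightarrow> 'a set \<Rightarrow> 'a set" where
  "downset X A = {x \<in> topspace X. \<exists>a\<in>A. spec_le X x a}"

definition upset :: "'a topology \<Rightarrow> 'a set \<Rightarrow> 'a set" where
  "upset X A = {x \<in> topspace X. \<exists>a\<in>A. spec_le X a x}"

definition compact_saturated :: "'a topology \<Rightarrow> 'a set set" where
  "compact_saturated X = {K. compactin X K \<and> K = upset X K}"

definition filtered_family :: "'a topology \<Rightarrow> 'a set set \<Rightarrow> bool" where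
  "filtered_family X \<K> \<longleftrightarrow> \<K> \<subseteq> compact_saturated X \<and> \<K> \<noteq> {} \<and>
     (\<forall>K\<^sub>1\<in>\<K>. \<forall>K\<^sub>2\<in>\<K>. \<exists>K\<in>\<K>. K \<subseteq> K\<^sub>1 \<and> K \<subseteq> K\<^sub>2)"

definition closed_meeting :: "'a topology \<Rightarrow> 'a set set \<Rightarrow> 'a set \<Rightarrow> bool" where
  "closed_meeting X \<K> C \<longleftrightarrow> closedin X C \<and> (\<forall>K\<in>\<K>. C \<inter> K \<noteq> {})"

definition KF_set :: "'a topology \<Rightarrow> 'a set \<Rightarrow> bool" where
  "KF_set X A \<longleftrightarrow> A \<subseteq> topspace X \<and> A \<noteq> {} \<and>
     (\<exists>\<K>. filtered_family X \<K> \<and> closed_meeting X \<K> (X closure_of A) \<and>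
        (\<forall>C. closed_meeting X \<K> C \<and> C \<subseteq> X closure_of A \<longrightarrow> C = X closure_of A))"

definition KF :: "'a topology \<Rightarrow> 'a set set" where
  "KF X = {A. closedin X A \<and> KF_set X A}"

definition well_filtered :: "'a topology \<Rightarrow> bool" where
  "well_filtered X \<longleftrightarrow>
     (\<forall>\<C> U. filtered_family X \<C> \<and> openin X U \<and> \<Inter>\<C> \<subseteq> U \<longrightarrow> (\<exists>K\<in>\<C>. K \<subseteq> U))"

text \<open>
  A definition cannot quantify over all types, so the test spaces \<open>Y\<close> are taken on the
  type \<open>'a set\<close>. This is no restriction: lemma \<open>WD_set_all_types\<close> below shows that a
  WD-set has the defining property for well-filtered \<open>T\<^sub>0\<close> spaces on every type.
\<close>

definition WD_set :: "'a topology \<Rightarrow> 'a set \<Rightarrow> bool" where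
  "WD_set X A \<longleftrightarrow> A \<subseteq> topspace X \<and>
     (\<forall>(Y :: 'a set topology) f. t0_space Y \<and> well_filtered Y \<and> continuous_map X Y f \<longrightarrow>
        (\<exists>!y. y \<in> topspace Y \<and> Y closure_of (f ` A) = Y closure_of {y}))"

definition WD :: "'a topology \<Rightarrow> 'a set set" where
  "WD X = {A. closedin X A \<and> WD_set X A}"

text \<open>
  Relativising to \<open>\<A>\<close> makes \<open>\<A>\<close> itself (the empty intersection of subbasic sets) open,
  so that the underlying set is \<open>\<A>\<close> for every family \<open>\<A>\<close>, even if \<open>{} \<in> \<A>\<close>.
\<close>

definition lower_vietoris :: "'a topology \<Rightarrow> 'a set set \<Rightarrow> 'a set topology" where
  "lower_vietoris X \<A> = topology (arbitrary union_of
     (finite intersection_of (\<lambda>\<U>. \<exists>U. openin X U \<and> \<U> = {A\<in>\<A>. A \<inter> U \<noteq> {}}) relative_to \<A>))"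

definition well_filterification :: "'a topology \<Rightarrow> 'a set topology" where
  "well_filterification X = lower_vietoris X (WD X)"

definition directed_in :: "'a set \<Rightarrow> ('a \<Rightarrow> 'a \<Rightarrow> bool) \<Rightarrow> 'a set \<Rightarrow> bool" where
  "directed_in P le D \<longleftrightarrow> D \<subseteq> P \<and> D \<noteq> {} \<and> (\<forall>x\<in>D. \<forall>y\<in>D. \<exists>z\<in>D. le x z \<and> le y z)"

definition is_sup_in :: "'a set \<Rightarrow> ('a \<Rightarrow> 'a \<Rightarrow> bool) \<Rightarrow> 'a set \<Rightarrow> 'a \<Rightarrow> bool" where
  "is_sup_in P le D s \<longleftrightarrow> s \<in> P \<and> (\<forall>x\<in>D. le x s) \<and> (\<forall>u\<in>P. (\<forall>x\<in>D. le x u) \<longrightarrow> le s u)"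

definition d_closed_in :: "'a set \<Rightarrow> ('a \<Rightarrow> 'a \<Rightarrow> bool) \<Rightarrow> 'a set \<Rightarrow> bool" where
  "d_closed_in P le B \<longleftrightarrow> B \<subseteq> P \<and>
     (\<forall>D s. directed_in P le D \<and> D \<subseteq> B \<and> is_sup_in P le D s \<longrightarrow> s \<in> B)"

definition d_closure :: "'a set \<Rightarrow> ('a \<Rightarrow> 'a \<Rightarrow> bool) \<Rightarrow> 'a set \<Rightarrow> 'a set" where
  "d_closure P le B = d_closed_in P le hull B"

definition monotone_convergence_space :: "'a topology \<Rightarrow> bool" where
  "monotone_convergence_space X \<longleftrightarrow> t0_space X \<and>
     (\<forall>D. directed_in (topspace X) (spec_le X) D \<longrightarrow>
        (\<exists>!x. x \<in> topspace X \<and> X closure_of D = X closure_of {x}))"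

definition is_D_completion :: "'a topology \<Rightarrow> 'b topology \<Rightarrow> ('a \<Rightarrow> 'b) \<Rightarrow> bool" where
  "is_D_completion X Y j \<longleftrightarrow> monotone_convergence_space Y \<and> embedding_map X Y j \<and>
     d_closure (topspace Y) (spec_le Y) (j ` topspace X) = topspace Y"

definition point_closures :: "'a topology \<Rightarrow> 'a set set" where
  "point_closures X = (\<lambda>x. X closure_of {x}) ` topspace X"

text \<open>
  The standard form of the D-completion, with embedding \<open>x \<mapsto> X closure_of {x}\<close>; lemma
  \<open>is_D_completion_D_completion\<close> below shows that it is a D-completion in the above sense.
\<close>

definition D_completion :: "'a topology \<Rightarrow> 'a set topology" where
  "D_completion X = lower_vietoris X
     (d_closure {C. closedin X C} (\<subseteq>) (point_closures X))"

lemma upset_subset: "K \<subseteq> topspace X \<Longrightarrow> K \<subseteq> upset X K"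
  by (auto simp: upset_def spec_le_def in_closure_of)

lemma spec_le_iff:
  "spec_le X x y \<longleftrightarrow> x \<in> topspace X \<and> y \<in> topspace X \<and> (\<forall>U. openin X U \<and> x \<in> U \<longrightarrow> y \<in> U)"
  by (auto simp: spec_le_def in_closure_of)

lemma spec_le_trans: "spec_le X x y \<Longrightarrow> spec_le X y z \<Longrightarrow> spec_le X x z"
  by (auto simp: spec_le_iff)

lemma spec_le_subtopology:
  assumes "Z \<subseteq> topspace X"
  shows "spec_le (subtopology X Z) x y \<longleftrightarrow> x \<in> Z \<and> y \<in> Z \<and> spec_le X x y"
  using assms by (auto simp: spec_le_iff openin_subtopology)

lemma upset_compact_saturated:
  assumes "compactin X K"
  shows "upset X K \<in> compact_saturated X"
proof -
  have K: "K \<subseteq> topspace X" using assms by (simp add: compactin_subset_topspace)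
  have up: "upset X K \<subseteq> U" if "openin X U" "K \<subseteq> U" for U
    using that by (auto simp: upset_def spec_le_iff)
  have "compactin X (upset X K)"
    unfolding compactin_def
  proof (intro conjI allI impI)
    show "upset X K \<subseteq> topspace X" by (auto simp: upset_def)
  next
    fix \<U> assume \<U>: "Ball \<U> (openin X) \<and> upset X K \<subseteq> \<Union>\<U>"
    then have "K \<subseteq> \<Union>\<U>" using upset_subset[OF K] by blast
    then obtain \<F> where \<F>: "finite \<F>" "\<F> \<subseteq> \<U>" "K \<subseteq> \<Union>\<F>"
      using assms \<U> by (auto simp: compactin_def)
    then have "openin X (\<Union>\<F>)" using \<U> by blast
    then have "upset X K \<subseteq> \<Union>\<F>" using \<F>(3) up by simp
    then show "\<exists>\<F>. finite \<F> \<and> \<F> \<subseteq> \<U> \<and> upset X K \<subseteq> \<Union>\<F>"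
      using \<F>(1,2) by (intro exI[of _ \<F>]) simp
  qed
  moreover have "upset X (upset X K) = upset X K"
  proof
    show "upset X (upset X K) \<subseteq> upset X K"
      unfolding upset_def using spec_le_trans by fastforce
    show "upset X K \<subseteq> upset X (upset X K)"
      by (intro upset_subset) (auto simp: upset_def)
  qed
  ultimately show ?thesis by (simp add: compact_saturated_def)
qed

lemma maximal_open_avoiding:
  assumes fil: "filtered_family X \<K>" and U: "openin X U" "\<And>K. K \<in> \<K> \<Longrightarrow> \<not> K \<subseteq> U"
  obtains M where "openin X M" "U \<subseteq> M" "\<And>K. K \<in> \<K> \<Longrightarrow> \<not> K \<subseteq> M"
    "\<And>N. openin X N \<Longrightarrow> M \<subseteq> N \<Longrightarrow> (\<And>K. K \<in> \<K> \<Longrightarrow> \<not> K \<subseteq> N) \<Longrightarrow> N = M"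
proof -
  define \<A> where "\<A> = {N. openin X N \<and> U \<subseteq> N \<and> (\<forall>K\<in>\<K>. \<not> K \<subseteq> N)}"
  have "\<exists>M\<in>\<A>. \<forall>N\<in>\<A>. M \<subseteq> N \<longrightarrow> N = M"
  proof (rule subset_Zorn_nonempty)
    show "\<A> \<noteq> {}" using U by (auto simp: \<A>_def)
  next
    fix \<C> assume ne: "\<C> \<noteq> {}" and ch: "subset.chain \<A> \<C>"
    have sub: "\<C> \<subseteq> \<A>" using ch by (simp add: subset.chain_def)
    have "\<not> K \<subseteq> \<Union>\<C>" if K: "K \<in> \<K>" for K
    proof
      assume "K \<subseteq> \<Union>\<C>"
      moreover have "compactin X K"
        using K fil by (auto simp: filtered_family_def compact_saturated_def)
      moreover have "Ball \<C> (openin X)" using sub by (auto simp: \<A>_def)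
      ultimately obtain \<F> where \<F>: "finite \<F>" "\<F> \<subseteq> \<C>" "K \<subseteq> \<Union>\<F>"
        unfolding compactin_def by blast
      show False
      proof (cases "\<F> = {}")
        case True
        then show False using \<F> K U by auto
      next
        case False
        have "subset.chain \<A> \<F>" using ch \<F>(2) subset_trans unfolding subset_chain_def
          by (metis subsetD)
        then have "\<Union>\<F> \<in> \<F>" using Union_in_chain[OF \<F>(1) False] by simp
        then show False using \<F> K sub by (auto simp: \<A>_def)
      qed
    qed
    then show "\<Union>\<C> \<in> \<A>" using sub ne by (auto simp: \<A>_def)
  qed
  then obtain M where "M \<in> \<A>" and max: "\<And>N. N \<in> \<A> \<Longrightarrow> M \<subseteq> N \<Longrightarrow> N = M" by blast
  then show ?thesis by (intro that[of M]) (auto simp: \<A>_def)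
qed

lemma well_filtered_subtopology:
  assumes Y: "well_filtered Y" and Z: "Z \<subseteq> topspace Y"
    and b: "\<And>y. y \<in> Y closure_of (Z \<inter> Y closure_of {y}) \<Longrightarrow> y \<in> Z"
  shows "well_filtered (subtopology Y Z)"
  unfolding well_filtered_def
proof (intro allI impI, rule ccontr)
  let ?Z = "subtopology Y Z"
  fix \<K> U assume *: "filtered_family ?Z \<K> \<and> openin ?Z U \<and> \<Inter>\<K> \<subseteq> U"
    and "\<not> (\<exists>K\<in>\<K>. K \<subseteq> U)"
  then obtain M where M: "openin ?Z M" "U \<subseteq> M" "\<And>K. K \<in> \<K> \<Longrightarrow> \<not> K \<subseteq> M"
    and max: "\<And>N. openin ?Z N \<Longrightarrow> M \<subseteq> N \<Longrightarrow> (\<And>K. K \<in> \<K> \<Longrightarrow> \<not> K \<subseteq> N) \<Longrightarrow> N = M"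
    using maximal_open_avoiding[of ?Z \<K> U] by metis
  have fil: "filtered_family ?Z \<K>" using * by simp
  have Kc: "compactin Y K" "K \<subseteq> Z" "K = upset ?Z K" if "K \<in> \<K>" for K
    using fil that by (auto simp: filtered_family_def compact_saturated_def compactin_subtopology)
  define V where "V = topspace Y - Y closure_of (Z - M)"
  have V: "openin Y V" by (auto simp: V_def)
  have VZ: "V \<inter> Z \<subseteq> M"
    using closure_of_subset[of "Z - M" Y] Z by (auto simp: V_def)
  have MV: "M \<subseteq> V"
  proof
    fix x assume x: "x \<in> M"
    obtain W where W: "openin Y W" "M = W \<inter> Z" using M(1) by (auto simp: openin_subtopology)
    then have "x \<in> W" "W \<inter> (Z - M) = {}" using x by auto
    then have "x \<notin> Y closure_of (Z - M)" using W by (auto simp: in_closure_of)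
    then show "x \<in> V" using x W Z by (auto simp: V_def)
  qed
  have mono: "upset Y K \<subseteq> upset Y L" if "K \<subseteq> L" for K L using that by (auto simp: upset_def)
  have "filtered_family Y (upset Y ` \<K>)"
    unfolding filtered_family_def
  proof (intro conjI)
    show "upset Y ` \<K> \<subseteq> compact_saturated Y" using upset_compact_saturated Kc by blast
    show "upset Y ` \<K> \<noteq> {}" using fil by (auto simp: filtered_family_def)
    show "\<forall>K\<^sub>1\<in>upset Y ` \<K>. \<forall>K\<^sub>2\<in>upset Y ` \<K>. \<exists>K\<in>upset Y ` \<K>. K \<subseteq> K\<^sub>1 \<and> K \<subseteq> K\<^sub>2"
      using fil mono unfolding filtered_family_def by (simp del: Int_iff) meson
  qed
  moreover have "\<not> upset Y K \<subseteq> V" if "K \<in> \<K>" for K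
    using upset_subset[of K Y] Kc[OF that] VZ M(3)[OF that] Z by blast
  ultimately have "\<not> \<Inter>(upset Y ` \<K>) \<subseteq> V"
    using Y V unfolding well_filtered_def by (metis (no_types, lifting) imageE)
  then obtain y where y: "\<And>K. K \<in> \<K> \<Longrightarrow> y \<in> upset Y K" and yV: "y \<notin> V" by auto
  obtain K0 where "K0 \<in> \<K>" using fil by (auto simp: filtered_family_def)
  then have yT: "y \<in> topspace Y" using y by (auto simp: upset_def)
  then have ycl: "y \<in> Y closure_of (Z - M)" using yV by (simp add: V_def)
  have cly: "Y closure_of {y} \<subseteq> Y closure_of (Z - M)"
    by (rule closure_of_minimal) (use ycl in auto)
  have "Z - Y closure_of {y} = M"
  proof (rule max)
    have "Z - Y closure_of {y} = Z \<inter> (topspace Y - Y closure_of {y})" using Z by auto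
    then show "openin ?Z (Z - Y closure_of {y})"
      by (auto simp: openin_subtopology_Int2 openin_diff)
    show "M \<subseteq> Z - Y closure_of {y}"
      using MV cly openin_subset[OF M(1)] by (auto simp: V_def)
    show "\<not> K \<subseteq> Z - Y closure_of {y}" if "K \<in> \<K>" for K
      using y[OF that] by (auto simp: upset_def spec_le_def)
  qed
  then have ZM: "Z - M = Z \<inter> Y closure_of {y}" by auto
  then have yZ: "y \<in> Z" using b ycl by simp
  have "y \<in> K" if "K \<in> \<K>" for K
  proof -
    have "y \<in> upset ?Z K"
      using y[OF that] yZ Kc(2)[OF that] yT by (auto simp: upset_def spec_le_subtopology[OF Z])
    then show ?thesis using Kc(3)[OF that] by simp
  qed
  then have "y \<in> M" using * M(2) by blast
  moreover have "y \<in> Y closure_of {y}" using yT by (simp add: in_closure_of)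
  ultimately show False using ZM yZ by blast
qed

lemma spec_le_homeomorphic_map:
  assumes "homeomorphic_map X Y f" "x \<in> topspace X" "x' \<in> topspace X"
  shows "spec_le Y (f x) (f x') \<longleftrightarrow> spec_le X x x'"
proof -
  have "Y closure_of {f x'} = f ` (X closure_of {x'})"
    using homeomorphic_map_closure_of[OF assms(1), of "{x'}"] assms(3) by simp
  moreover have "inj_on f (topspace X)" "f x' \<in> topspace Y"
    using assms homeomorphic_map_def homeomorphic_imp_surjective_map by blast+
  ultimately show ?thesis
    using assms(2,3) closure_of_subset_topspace[of X "{x'}"]
    by (auto simp: spec_le_def inj_on_image_mem_iff)
qed

lemma well_filtered_homeomorphic_map:
  assumes f: "homeomorphic_map X Y f" and Y: "well_filtered Y"
  shows "well_filtered X"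
  unfolding well_filtered_def
proof (intro allI impI)
  have inj: "inj_on f (topspace X)" and surj: "f ` topspace X = topspace Y"
    using f homeomorphic_map_def homeomorphic_imp_surjective_map by blast+
  fix \<C> U assume *: "filtered_family X \<C> \<and> openin X U \<and> \<Inter>\<C> \<subseteq> U"
  have UT: "U \<subseteq> topspace X" using * openin_subset by blast
  have KT: "K \<subseteq> topspace X" "compactin X K" "K = upset X K" if "K \<in> \<C>" for K
    using * that compactin_subset_topspace by (auto simp: filtered_family_def compact_saturated_def)
  have sat: "f ` K \<in> compact_saturated Y" if K: "K \<in> \<C>" for K
  proof -
    have "compactin Y (f ` K)"
      using KT[OF K] f by (metis homeomorphic_map_compactness)
    moreover have "upset Y (f ` K) \<subseteq> f ` K"
    proof
      fix y assume "y \<in> upset Y (f ` K)"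
      then obtain k where k: "k \<in> K" "y \<in> topspace Y" "spec_le Y (f k) y"
        by (auto simp: upset_def)
      then obtain x where x: "x \<in> topspace X" "y = f x" using surj by auto
      have "k \<in> topspace X" using k KT[OF K] by auto
      then have "spec_le X k x" using spec_le_homeomorphic_map[OF f] k x by simp
      then have "x \<in> upset X K" using k x by (auto simp: upset_def)
      then show "y \<in> f ` K" using KT(3)[OF K] x by auto
    qed
    moreover have "f ` K \<subseteq> upset Y (f ` K)"
      using KT[OF K] surj by (intro upset_subset) auto
    ultimately show ?thesis by (auto simp: compact_saturated_def)
  qed
  have "filtered_family Y ((`) f ` \<C>)"
    unfolding filtered_family_def
  proof (intro conjI ballI)
    show "(`) f ` \<C> \<subseteq> compact_saturated Y" using sat by blast
    show "(`) f ` \<C> \<noteq> {}" using * by (auto simp: filtered_family_def)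
    fix K\<^sub>1 K\<^sub>2 assume "K\<^sub>1 \<in> (`) f ` \<C>" "K\<^sub>2 \<in> (`) f ` \<C>"
    then obtain L\<^sub>1 L\<^sub>2 where L: "L\<^sub>1 \<in> \<C>" "L\<^sub>2 \<in> \<C>" "K\<^sub>1 = f ` L\<^sub>1" "K\<^sub>2 = f ` L\<^sub>2" by blast
    then obtain K where "K \<in> \<C>" "K \<subseteq> L\<^sub>1" "K \<subseteq> L\<^sub>2"
      using * unfolding filtered_family_def by metis
    then show "\<exists>K\<in>(`) f ` \<C>. K \<subseteq> K\<^sub>1 \<and> K \<subseteq> K\<^sub>2"
      using L by (intro bexI[of _ "f ` K"]) auto
  qed
  moreover have "openin Y (f ` U)"
    using * f UT by (metis homeomorphic_map_openness)
  moreover have "\<Inter>((`) f ` \<C>) \<subseteq> f ` U"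
  proof
    fix y assume y: "y \<in> \<Inter>((`) f ` \<C>)"
    obtain K0 where "K0 \<in> \<C>" using * by (auto simp: filtered_family_def)
    then obtain x where x: "x \<in> topspace X" "y = f x" using y KT by blast
    have "x \<in> K" if "K \<in> \<C>" for K
    proof -
      have "f x \<in> f ` K" using y that x by auto
      then show ?thesis using inj_on_image_mem_iff[OF inj x(1) KT(1)[OF that]] by simp
    qed
    then have "x \<in> U" using * by blast
    then show "y \<in> f ` U" using x by blast
  qed
  ultimately obtain K where "K \<in> \<C>" "f ` K \<subseteq> f ` U"
    using Y unfolding well_filtered_def by (metis (no_types, lifting) imageE)
  then show "\<exists>K\<in>\<C>. K \<subseteq> U"
    using inj_on_image_eq_iff[OF inj] KT(1) UT inj by (metis image_Un le_sup_iff subset_Un_eq)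
qed

lemma WD_set_all_types:
  fixes Y :: "'b topology"
  assumes A: "WD_set X A" and t0: "t0_space Y" and wf: "well_filtered Y"
    and f: "continuous_map X Y f"
  shows "\<exists>!y. y \<in> topspace Y \<and> Y closure_of (f ` A) = Y closure_of {y}"
proof -
  have fX: "f x \<in> topspace Y" if "x \<in> topspace X" for x
    using f that by (auto simp: continuous_map_def)
  define F where "F = f ` topspace X"
  define Z where "Z = {y. y \<in> Y closure_of (F \<inter> Y closure_of {y})}"
  have Z: "Z \<subseteq> topspace Y" by (auto simp: Z_def in_closure_of)
  have FZ: "F \<subseteq> Z" using fX by (auto simp: F_def Z_def in_closure_of)
  have wfZ: "well_filtered (subtopology Y Z)"
  proof (rule well_filtered_subtopology[OF wf Z])
    fix y assume y: "y \<in> Y closure_of (Z \<inter> Y closure_of {y})"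
    have "\<exists>z\<in>F \<inter> Y closure_of {y}. z \<in> U" if U: "openin Y U" "y \<in> U" for U
    proof -
      obtain z where z: "z \<in> Z" "z \<in> Y closure_of {y}" "z \<in> U"
        using y U by (auto simp: in_closure_of)
      have "Y closure_of {z} \<subseteq> Y closure_of {y}"
        by (rule closure_of_minimal) (use z in auto)
      moreover have "\<exists>w. w \<in> F \<inter> Y closure_of {z} \<and> w \<in> U"
      proof -
        have "z \<in> Y closure_of (F \<inter> Y closure_of {z})" using z(1) by (simp add: Z_def)
        then show ?thesis using z(3) U(1) unfolding in_closure_of[of z] by blast
      qed
      ultimately show ?thesis by blast
    qed
    moreover have "y \<in> topspace Y" using y by (simp add: in_closure_of)
    ultimately show "y \<in> Z" unfolding Z_def mem_Collect_eq in_closure_of[of y] by blast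
  qed
  define g where "g y = {x \<in> topspace X. f x \<in> Y closure_of {y}}" for y
  have le: "spec_le Y y y'" if "y \<in> Z" "y' \<in> Z" "g y = g y'" for y y'
  proof -
    have "F \<inter> Y closure_of {y} \<subseteq> Y closure_of {y'}"
      using that(3) by (auto simp: g_def F_def)
    then have "Y closure_of (F \<inter> Y closure_of {y}) \<subseteq> Y closure_of {y'}"
      by (simp add: closure_of_minimal)
    then show ?thesis using that Z by (auto simp: Z_def spec_le_def)
  qed
  have inj: "inj_on g Z"
  proof (rule inj_onI)
    fix y y' assume "y \<in> Z" "y' \<in> Z" "g y = g y'"
    then have "spec_le Y y y'" "spec_le Y y' y" using le by simp_all
    then have "y \<in> topspace Y" "y' \<in> topspace Y" "\<And>U. openin Y U \<Longrightarrow> y \<in> U \<longleftrightarrow> y' \<in> U"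
      unfolding spec_le_iff by metis+
    then show "y = y'" using t0 unfolding t0_space_def by metis
  qed
  define h where "h = inv_into Z g"
  define T where "T = pullback_topology (g ` Z) h (subtopology Y Z)"
  have topT: "topspace T = g ` Z"
    using inj Z by (auto simp: T_def topspace_pullback_topology h_def)
  have hT: "homeomorphic_map T (subtopology Y Z) h"
    unfolding homeomorphic_map_maps
  proof (rule exI[of _ g], unfold homeomorphic_maps_def, intro conjI ballI)
    show "continuous_map T (subtopology Y Z) h"
      using continuous_map_pullback[of "subtopology Y Z" "subtopology Y Z" id "g ` Z" h]
      by (simp add: T_def)
    show "continuous_map (subtopology Y Z) T g"
      unfolding T_def
    proof (rule continuous_map_pullback')
      have "continuous_map (subtopology Y Z) (subtopology Y Z) id" by simp
      then show "continuous_map (subtopology Y Z) (subtopology Y Z) (h \<circ> g)"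
        by (rule continuous_map_eq) (use inj in \<open>auto simp: h_def\<close>)
      show "topspace (subtopology Y Z) \<subseteq> g -` (g ` Z)" by auto
    qed
  next
    fix x assume "x \<in> topspace T"
    then show "g (h x) = x" using topT by (auto simp: h_def f_inv_into_f)
  next
    fix y assume "y \<in> topspace (subtopology Y Z)"
    then show "h (g y) = y" using inj by (simp add: h_def)
  qed
  have wfT: "well_filtered T" using well_filtered_homeomorphic_map[OF hT wfZ] .
  have t0T: "t0_space T"
    using homeomorphic_t0_space[OF homeomorphic_map_imp_homeomorphic_space[OF hT]]
      t0_space_subtopology[OF t0] by simp
  have hg: "h (g y) = y" if "y \<in> Z" for y using that inj by (simp add: h_def)
  have fZ: "continuous_map X (subtopology Y Z) f"
    using f FZ by (simp add: continuous_map_in_subtopology F_def image_subset_iff_funcset)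
  have hgf: "continuous_map X (subtopology Y Z) (h \<circ> (g \<circ> f))"
    by (rule continuous_map_eq[OF fZ]) (use FZ hg in \<open>auto simp: F_def\<close>)
  have "f x \<in> Z" if "x \<in> topspace X" for x using FZ that by (auto simp: F_def)
  then have "topspace X \<subseteq> (g \<circ> f) -` (g ` Z)" by (simp add: subset_iff)
  with hgf have gf: "continuous_map X T (g \<circ> f)"
    unfolding T_def by (rule continuous_map_pullback'[of X "subtopology Y Z" h "g \<circ> f"])
  have AT: "A \<subseteq> topspace X" using A by (simp add: WD_set_def)
  have "t0_space T \<and> well_filtered T \<and> continuous_map X T (g \<circ> f)"
    using t0T wfT gf by simp
  then have "\<exists>!t. t \<in> topspace T \<and> T closure_of ((g \<circ> f) ` A) = T closure_of {t}"
    by (rule A[unfolded WD_set_def, THEN conjunct2, rule_format])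
  then obtain z where z: "z \<in> Z" "T closure_of ((g \<circ> f) ` A) = T closure_of {g z}"
    unfolding topT by auto
  have fAZ: "f ` A \<subseteq> Z" using AT FZ by (auto simp: F_def)
  have "subtopology Y Z closure_of (h ` ((g \<circ> f) ` A)) = subtopology Y Z closure_of (h ` {g z})"
  proof -
    have "(g \<circ> f) ` A \<subseteq> topspace T" "{g z} \<subseteq> topspace T" using fAZ z topT by auto
    then show ?thesis using homeomorphic_map_closure_of[OF hT] z(2) by metis
  qed
  moreover have "h ` ((g \<circ> f) ` A) = f ` A" using fAZ hg by (force simp: image_image)
  ultimately have eq: "subtopology Y Z closure_of (f ` A) = subtopology Y Z closure_of {z}"
    using hg z by simp
  have Zsub: "subtopology Y Z closure_of S \<subseteq> Y closure_of S" for S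
    by (rule closure_of_subtopology_subset)
  have "f ` A \<subseteq> subtopology Y Z closure_of (f ` A)" "{z} \<subseteq> subtopology Y Z closure_of {z}"
    using fAZ z(1) Z by (intro closure_of_subset; auto)+
  then have 1: "f ` A \<subseteq> Y closure_of {z}" and 2: "z \<in> Y closure_of (f ` A)"
    using eq Zsub[of "f ` A"] Zsub[of "{z}"] by (metis subset_trans, metis insert_subset subsetD)
  have "Y closure_of (f ` A) = Y closure_of {z}"
    using closure_of_minimal[OF 1 closedin_closure_of] closure_of_minimal[of "{z}" "Y closure_of (f ` A)" Y] 2
    by auto
  then show ?thesis
    using z(1) Z t0 unfolding t0_space_closure_of_sing by (intro ex1I[of _ z]) auto
qed

lemma topspace_lower_vietoris [simp]: "topspace (lower_vietoris X \<A>) = \<A>"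
  by (simp add: lower_vietoris_def)

lemma lower_vietoris_eq_iff: "lower_vietoris X \<A> = lower_vietoris X \<B> \<longleftrightarrow> \<A> = \<B>"
  by (metis topspace_lower_vietoris)

lemma openin_lower_vietoris:
  assumes "openin X U"
  shows "openin (lower_vietoris X \<A>) {A\<in>\<A>. A \<inter> U \<noteq> {}}"
proof -
  let ?S = "\<lambda>\<U>. \<exists>U. openin X U \<and> \<U> = {A\<in>\<A>. A \<inter> U \<noteq> {}}"
  have "(finite intersection_of ?S relative_to \<A>) {A\<in>\<A>. A \<inter> U \<noteq> {}}"
    using assms by (intro relative_to_subset_inc finite_intersection_of_inc) auto
  then show ?thesis
    unfolding lower_vietoris_def openin_subbase by (rule arbitrary_union_of_inc)
qed

lemma openin_lower_vietoris_basis: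
  assumes "openin (lower_vietoris X \<A>) W" "A \<in> W"
  obtains \<F> where "finite \<F>" "\<And>U. U \<in> \<F> \<Longrightarrow> openin X U \<and> A \<inter> U \<noteq> {}" "A \<in> \<A>"
    "\<And>B. B \<in> \<A> \<Longrightarrow> (\<And>U. U \<in> \<F> \<Longrightarrow> B \<inter> U \<noteq> {}) \<Longrightarrow> B \<in> W"
proof -
  obtain \<G> where \<G>: "finite \<G>" "\<And>G. G \<in> \<G> \<Longrightarrow> \<exists>U. openin X U \<and> G = {A\<in>\<A>. A \<inter> U \<noteq> {}}"
    and A: "A \<in> \<A> \<inter> \<Inter>\<G>" and sub: "\<A> \<inter> \<Inter>\<G> \<subseteq> W"
  proof -
    let ?S = "\<lambda>\<U>. \<exists>U. openin X U \<and> \<U> = {A\<in>\<A>. A \<inter> U \<noteq> {}}"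
    obtain \<W> where \<W>: "\<W> \<subseteq> Collect (finite intersection_of ?S relative_to \<A>)" "\<Union>\<W> = W"
    proof -
      have "(arbitrary union_of (finite intersection_of ?S relative_to \<A>)) W"
        using assms(1) unfolding lower_vietoris_def openin_subbase .
      then show thesis using that unfolding union_of_def by blast
    qed
    then obtain N where N: "N \<in> \<W>" "A \<in> N" using assms(2) by blast
    then have "(finite intersection_of ?S relative_to \<A>) N" using \<W>(1) by blast
    then obtain \<G> where "finite \<G>" "\<G> \<subseteq> Collect ?S" "\<A> \<inter> \<Inter>\<G> = N"
      unfolding relative_to_def intersection_of_def by auto
    moreover have "N \<subseteq> W" using N \<W>(2) by blast
    ultimately show ?thesis using N(2) by (intro that[of \<G>]) auto
  qed
  obtain u where u: "\<And>G. G \<in> \<G> \<Longrightarrow> openin X (u G) \<and> G = {A\<in>\<A>. A \<inter> u G \<noteq> {}}"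
    using \<G>(2) by metis
  show ?thesis
  proof (rule that[of "u ` \<G>"])
    show "finite (u ` \<G>)" using \<G> by simp
    show "A \<in> \<A>" using A by simp
    show "openin X U \<and> A \<inter> U \<noteq> {}" if "U \<in> u ` \<G>" for U
      using that u A by blast
    show "B \<in> W" if B: "B \<in> \<A>" "\<And>U. U \<in> u ` \<G> \<Longrightarrow> B \<inter> U \<noteq> {}" for B
    proof -
      have "B \<in> G" if G: "G \<in> \<G>" for G
      proof -
        have "B \<in> {A\<in>\<A>. A \<inter> u G \<noteq> {}}" using G B by simp
        then show ?thesis using u[OF G] by simp
      qed
      then show ?thesis using B(1) sub by blast
    qed
  qed
qed

lemma spec_le_lower_vietoris:
  assumes \<A>: "\<And>A. A \<in> \<A> \<Longrightarrow> closedin X A"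
  shows "spec_le (lower_vietoris X \<A>) A B \<longleftrightarrow> A \<in> \<A> \<and> B \<in> \<A> \<and> A \<subseteq> B"
proof
  assume le: "spec_le (lower_vietoris X \<A>) A B"
  then have AB: "A \<in> \<A>" "B \<in> \<A>" by (auto simp: spec_le_iff)
  have "openin X (topspace X - B)" using \<A>[OF AB(2)] by auto
  from openin_lower_vietoris[OF this, of \<A>] le AB
  have "A \<inter> (topspace X - B) \<noteq> {} \<Longrightarrow> B \<inter> (topspace X - B) \<noteq> {}"
    unfolding spec_le_iff by blast
  then show "A \<in> \<A> \<and> B \<in> \<A> \<and> A \<subseteq> B"
    using AB closedin_subset[OF \<A>[OF AB(1)]] by blast
next
  assume AB: "A \<in> \<A> \<and> B \<in> \<A> \<and> A \<subseteq> B"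
  show "spec_le (lower_vietoris X \<A>) A B"
    unfolding spec_le_iff
  proof (intro conjI allI impI)
    fix W assume W: "openin (lower_vietoris X \<A>) W \<and> A \<in> W"
    then obtain \<F> where "\<And>U. U \<in> \<F> \<Longrightarrow> openin X U \<and> A \<inter> U \<noteq> {}"
      "\<And>B. B \<in> \<A> \<Longrightarrow> (\<And>U. U \<in> \<F> \<Longrightarrow> B \<inter> U \<noteq> {}) \<Longrightarrow> B \<in> W"
      using openin_lower_vietoris_basis[of X \<A> W A] by metis
    then show "B \<in> W" using AB by blast
  qed (use AB in auto)
qed

lemma d_closed_in_d_closure:
  assumes "B \<subseteq> P"
  shows "d_closed_in P le (d_closure P le B)"
proof -
  have "d_closed_in P le P" by (auto simp: d_closed_in_def is_sup_in_def)
  then have "\<Inter>{C. d_closed_in P le C \<and> B \<subseteq> C} \<subseteq> P" using assms by blast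
  then show ?thesis
    unfolding d_closure_def hull_def d_closed_in_def by blast
qed

lemma is_sup_in_closed:
  assumes "\<And>C. C \<in> \<D> \<Longrightarrow> closedin X C"
  shows "is_sup_in {C. closedin X C} (\<subseteq>) \<D> (X closure_of \<Union>\<D>)"
proof -
  have "\<Union>\<D> \<subseteq> X closure_of \<Union>\<D>"
    using assms closedin_subset by (intro closure_of_subset) blast
  then show ?thesis by (auto simp: is_sup_in_def closure_of_minimal Union_least)
qed

lemma is_D_completion_D_completion:
  assumes X: "t0_space X"
  shows "is_D_completion X (D_completion X) (\<lambda>x. X closure_of {x})"
proof -
  define \<A> where "\<A> = d_closure {C. closedin X C} (\<subseteq>) (point_closures X)"
  define V where "V = lower_vietoris X \<A>"
  have P: "point_closures X \<subseteq> {C. closedin X C}" by (auto simp: point_closures_def)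
  have dA: "d_closed_in {C. closedin X C} (\<subseteq>) \<A>"
    unfolding \<A>_def by (rule d_closed_in_d_closure[OF P])
  then have cl: "closedin X A" if "A \<in> \<A>" for A using that by (auto simp: d_closed_in_def)
  have PA: "point_closures X \<subseteq> \<A>" by (simp add: \<A>_def d_closure_def hull_subset)
  have topV: "topspace V = \<A>" by (simp add: V_def)
  have le: "spec_le V A B \<longleftrightarrow> A \<in> \<A> \<and> B \<in> \<A> \<and> A \<subseteq> B" for A B
    unfolding V_def by (rule spec_le_lower_vietoris) (rule cl)
  have sup: "X closure_of \<Union>\<D> \<in> \<A>" if "directed_in \<A> (\<subseteq>) \<D>" for \<D>
  proof -
    have "is_sup_in {C. closedin X C} (\<subseteq>) \<D> (X closure_of \<Union>\<D>)"
      using that cl by (intro is_sup_in_closed) (auto simp: directed_in_def)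
    moreover have "directed_in {C. closedin X C} (\<subseteq>) \<D>" "\<D> \<subseteq> \<A>"
      using that cl by (auto simp: directed_in_def)
    ultimately show ?thesis using dA unfolding d_closed_in_def by blast
  qed
  have dir: "directed_in \<A> (spec_le V) \<D> \<longleftrightarrow> directed_in \<A> (\<subseteq>) \<D>" for \<D>
    unfolding directed_in_def le by (intro conj_cong refl ball_cong bex_cong) auto
  have t0: "t0_space V"
  proof -
    have "A = B" if "A \<in> \<A>" "B \<in> \<A>" "V closure_of {A} = V closure_of {B}" for A B
    proof -
      have "A \<in> V closure_of {A}" "B \<in> V closure_of {B}" using that(1,2) topV by (auto simp: in_closure_of)
      then have "A \<in> V closure_of {B}" "B \<in> V closure_of {A}" using that(3) by simp_all
      then have "spec_le V A B" "spec_le V B A" using that(1,2) topV by (simp_all add: spec_le_def)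
      then show ?thesis unfolding le by auto
    qed
    then show ?thesis unfolding t0_space_closure_of_sing topV by blast
  qed
  have mc: "monotone_convergence_space V"
    unfolding monotone_convergence_space_def topV dir
  proof (intro conjI t0 allI impI)
    fix \<D> assume \<D>: "directed_in \<A> (\<subseteq>) \<D>"
    let ?S = "X closure_of \<Union>\<D>"
    have S: "?S \<in> \<A>" by (rule sup[OF \<D>])
    have DA: "\<D> \<subseteq> \<A>" using \<D> by (simp add: directed_in_def)
    have DS: "D \<subseteq> ?S" if "D \<in> \<D>" for D
      using is_sup_in_closed[of \<D> X] DA cl that by (auto simp: is_sup_in_def)
    have "\<D> \<subseteq> V closure_of {?S}"
    proof
      fix D assume "D \<in> \<D>"
      then have "spec_le V D ?S" using DA S DS le by blast
      then show "D \<in> V closure_of {?S}" by (simp add: spec_le_def)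
    qed
    moreover have "?S \<in> V closure_of \<D>"
      unfolding in_closure_of
    proof (intro conjI allI impI)
      show "?S \<in> topspace V" using S topV by simp
      fix W assume W: "?S \<in> W \<and> openin V W"
      then obtain \<F> where \<F>: "finite \<F>" "\<And>U. U \<in> \<F> \<Longrightarrow> openin X U \<and> ?S \<inter> U \<noteq> {}"
        "\<And>B. B \<in> \<A> \<Longrightarrow> (\<And>U. U \<in> \<F> \<Longrightarrow> B \<inter> U \<noteq> {}) \<Longrightarrow> B \<in> W"
        using openin_lower_vietoris_basis[of X \<A> W ?S] unfolding V_def by metis
      have "\<exists>D\<in>\<D>. \<forall>U\<in>\<F>. D \<inter> U \<noteq> {}"
        using \<F>(1,2)
      proof (induction \<F>)
        case empty
        then show ?case using \<D> by (auto simp: directed_in_def)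
      next
        case (insert U \<F>)
        then obtain D where D: "D \<in> \<D>" "\<forall>U\<in>\<F>. D \<inter> U \<noteq> {}" by auto
        have "openin X U" "?S \<inter> U \<noteq> {}" using insert.prems by auto
        then have "\<Union>\<D> \<inter> U \<noteq> {}" by (simp add: openin_Int_closure_of_eq_empty Int_commute)
        then obtain E where E: "E \<in> \<D>" "E \<inter> U \<noteq> {}" by blast
        obtain G where G: "G \<in> \<D>" "D \<subseteq> G" "E \<subseteq> G"
          using \<D> D(1) E(1) unfolding directed_in_def by blast
        have "G \<inter> W \<noteq> {}" if W: "W \<in> insert U \<F>" for W
        proof -
          have "D \<inter> W \<subseteq> G \<inter> W" "E \<inter> W \<subseteq> G \<inter> W" using G by blast+
          then show ?thesis using W D(2) E(2) by (metis insertE subset_empty)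
        qed
        then show ?case using G(1) by blast
      qed
      then show "\<exists>D. D \<in> \<D> \<and> D \<in> W" using \<F>(3) DA by blast
    qed
    ultimately have "V closure_of \<D> = V closure_of {?S}"
      by (simp add: closure_of_minimal subset_antisym)
    then show "\<exists>!S. S \<in> \<A> \<and> V closure_of \<D> = V closure_of {S}"
      using S t0 unfolding t0_space_closure_of_sing topV by (intro ex1I[of _ ?S]) auto
  qed
  let ?j = "\<lambda>x. X closure_of {x}"
  have j: "?j ` topspace X = point_closures X" by (simp add: point_closures_def)
  have hit: "?j x \<inter> U \<noteq> {} \<longleftrightarrow> x \<in> U" if "openin X U" "x \<in> topspace X" for x U
    using that by (auto simp: in_closure_of)
  have "embedding_map X V ?j"
    unfolding embedding_map_def
  proof (rule bijective_open_imp_homeomorphic_map)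
    show "?j ` topspace X = topspace (subtopology V (?j ` topspace X))"
      using PA j topV by auto
    show "inj_on ?j (topspace X)"
      using X unfolding t0_space_closure_of_sing inj_on_def by blast
    show "continuous_map X (subtopology V (?j ` topspace X)) ?j"
      unfolding continuous_map_in_subtopology
    proof (intro conjI)
      show "continuous_map X V ?j"
        unfolding continuous_map_def
      proof (intro conjI allI impI)
        show "?j \<in> topspace X \<rightarrow> topspace V" using PA j topV by auto
        fix W assume W: "openin V W"
        show "openin X {x \<in> topspace X. ?j x \<in> W}"
        proof (subst openin_subopen, intro ballI)
          fix x assume "x \<in> {x \<in> topspace X. ?j x \<in> W}"
          then have x: "x \<in> topspace X" "?j x \<in> W" by auto
          then obtain \<F> where \<F>: "finite \<F>" "\<And>U. U \<in> \<F> \<Longrightarrow> openin X U \<and> ?j x \<inter> U \<noteq> {}"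
            "\<And>B. B \<in> \<A> \<Longrightarrow> (\<And>U. U \<in> \<F> \<Longrightarrow> B \<inter> U \<noteq> {}) \<Longrightarrow> B \<in> W"
            using openin_lower_vietoris_basis[of X \<A> W "?j x"] W unfolding V_def by metis
          let ?U = "topspace X \<inter> \<Inter>\<F>"
          have "openin X ?U" using \<F>(1,2) by (induction \<F>) (auto simp: Int_left_commute)
          moreover have "x \<in> ?U" using \<F>(2) hit x by blast
          moreover have "?U \<subseteq> {x \<in> topspace X. ?j x \<in> W}"
          proof
            fix z assume z: "z \<in> ?U"
            have "?j z \<in> \<A>" using z PA j by auto
            moreover have "?j z \<inter> U \<noteq> {}" if "U \<in> \<F>" for U
              using hit[of U z] \<F>(2)[OF that] that z by blast
            ultimately show "z \<in> {x \<in> topspace X. ?j x \<in> W}" using \<F>(3) z by simp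
          qed
          ultimately show "\<exists>T. openin X T \<and> x \<in> T \<and> T \<subseteq> {x \<in> topspace X. ?j x \<in> W}" by blast
        qed
      qed
    qed auto
    show "open_map X (subtopology V (?j ` topspace X)) ?j"
      unfolding open_map_def
    proof (intro allI impI)
      fix U assume U: "openin X U"
      have "?j ` U = {A\<in>\<A>. A \<inter> U \<noteq> {}} \<inter> ?j ` topspace X"
      proof (intro equalityI subsetI)
        fix A assume "A \<in> ?j ` U"
        then obtain x where "x \<in> U" "A = ?j x" by auto
        then show "A \<in> {A\<in>\<A>. A \<inter> U \<noteq> {}} \<inter> ?j ` topspace X"
          using hit[OF U, of x] openin_subset[OF U] PA j by blast
      next
        fix A assume "A \<in> {A\<in>\<A>. A \<inter> U \<noteq> {}} \<inter> ?j ` topspace X"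
        then show "A \<in> ?j ` U" using hit[OF U] by blast
      qed
      then show "openin (subtopology V (?j ` topspace X)) (?j ` U)"
        unfolding V_def openin_subtopology using openin_lower_vietoris[OF U, of \<A>]
        by (intro exI[of _ "{A\<in>\<A>. A \<inter> U \<noteq> {}}"] conjI)
    qed
  qed
  moreover have "d_closure \<A> (spec_le V) (point_closures X) = \<A>"
  proof
    show "d_closure \<A> (spec_le V) (point_closures X) \<subseteq> \<A>"
      using d_closed_in_d_closure[OF PA] by (auto simp: d_closed_in_def)
    have "\<A> \<subseteq> B" if B: "d_closed_in \<A> (spec_le V) B" "point_closures X \<subseteq> B" for B
      unfolding \<A>_def d_closure_def
    proof (rule hull_minimal[OF B(2)], unfold d_closed_in_def, intro conjI allI impI)
      have BA: "B \<subseteq> \<A>" using B(1) by (simp add: d_closed_in_def)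
      then show "B \<subseteq> {C. closedin X C}" using cl by blast
      fix \<D> S
      assume *: "directed_in {C. closedin X C} (\<subseteq>) \<D> \<and> \<D> \<subseteq> B \<and> is_sup_in {C. closedin X C} (\<subseteq>) \<D> S"
      then have "S \<in> \<A>" using dA BA unfolding d_closed_in_def by blast
      then have "is_sup_in \<A> (spec_le V) \<D> S"
      proof -
        assume SA: "S \<in> \<A>"
        have DA: "\<D> \<subseteq> \<A>" using * BA by blast
        have up: "\<And>x. x \<in> \<D> \<Longrightarrow> x \<subseteq> S"
          and least: "\<And>u. closedin X u \<Longrightarrow> (\<And>x. x \<in> \<D> \<Longrightarrow> x \<subseteq> u) \<Longrightarrow> S \<subseteq> u"
          using * unfolding is_sup_in_def by simp_all
        show ?thesis
          unfolding is_sup_in_def le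
        proof (intro conjI ballI impI)
          fix u assume u: "u \<in> \<A>" "\<forall>x\<in>\<D>. x \<in> \<A> \<and> u \<in> \<A> \<and> x \<subseteq> u"
          show "S \<subseteq> u" by (rule least[OF cl[OF u(1)]]) (use u(2) in simp)
        qed (use SA DA up in auto)
      qed
      moreover have "directed_in \<A> (spec_le V) \<D>"
        unfolding dir using * BA by (auto simp: directed_in_def)
      ultimately show "S \<in> B" using * B(1) unfolding d_closed_in_def by blast
    qed
    then show "\<A> \<subseteq> d_closure \<A> (spec_le V) (point_closures X)"
      unfolding d_closure_def hull_def by blast
  qed
  ultimately show ?thesis
    using mc unfolding is_D_completion_def D_completion_def \<A>_def[symmetric] V_def[symmetric] topV j
    by blast
qed

end

theory Submission
  imports Defs
begin

text \<open>
  Both spaces carry the lower Vietoris topology, so it suffices to compare their points: the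
  \<open>d\<close>-closure \<open>\<D>\<close> of the point closures in the lattice of closed sets, and the family of closed
  \<open>WD\<close>-sets, which by hypothesis is the family of closed \<open>KF\<close>-sets.

  \<open>\<D>\<close> consists of \<open>WD\<close>-sets for every space, because the closed \<open>WD\<close>-sets contain the point
  closures and are closed under directed suprema (\<open>WD_closure_of_Union\<close>): the points that represent
  the images of the members form a directed subset of the well-filtered test space, and
  well-filteredness supplies a suitable upper bound of it.

  Conversely, let the closed set \<open>A\<close> be minimal among the closed sets that meet every member of the
  filtered family \<open>\<K>\<close>. By hypothesis the sets \<open>\<down>(K \<inter> A) \<subseteq> A\<close> are closed, so such a set is all of \<open>A\<close> as
  soon as it meets every member of \<open>\<K>\<close>. For \<open>K \<in> \<K>\<close> this yields \<open>A = \<down>(K \<inter> A)\<close>: each point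
  of \<open>A\<close> lies below points of \<open>A\<close> in every member of \<open>\<K>\<close>. Given \<open>m \<in> A\<close>, this says exactly that
  \<open>\<down>(\<up>m \<inter> A)\<close> meets every member of \<open>\<K>\<close>; since \<open>\<up>m\<close> is compact saturated as well,
  \<open>A = \<down>(\<up>m \<inter> A)\<close>. As \<open>m\<close> was arbitrary, any two points of \<open>A\<close> have an upper bound in \<open>A\<close>
  (\<open>directed_in_KF\<close>). So \<open>A\<close> is directed, hence the supremum of a directed family of point
  closures: a single directed supremum reaches it.
\<close>

lemma downset_Int_closedin_subset:
  assumes "closedin X A"
  shows "downset X (K \<inter> A) \<subseteq> A"
proof
  fix x assume "x \<in> downset X (K \<inter> A)"
  then obtain a where a: "a \<in> A" "x \<in> X closure_of {a}"
    by (auto simp: downset_def spec_le_def)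
  have "X closure_of {a} \<subseteq> A"
    using a(1) assms by (intro closure_of_minimal) auto
  then show "x \<in> A" using a(2) by blast
qed

lemma spec_le_refl: "x \<in> topspace X \<Longrightarrow> spec_le X x x"
  by (simp add: spec_le_iff)

lemma closure_of_singleton_subset_iff:
  "x \<in> topspace X \<Longrightarrow> X closure_of {x} \<subseteq> X closure_of S \<longleftrightarrow> x \<in> X closure_of S"
  by (metis closedin_closure_of closure_of_minimal closure_of_subset empty_subsetI
      insert_subset subsetD)

text \<open>
  Minimality of \<open>A\<close> is used twice, for \<open>K \<in> \<K>\<close> and for \<open>K = \<up>m\<close>: the first use is what shows that
  the closed set in the second one meets every member of \<open>\<K>\<close>.
\<close>

lemma directed_in_KF:
  assumes A: "A \<in> KF X"
    and cl: "\<And>K. K \<in> compact_saturated X \<Longrightarrow> closedin X (downset X (K \<inter> A))"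
  shows "directed_in A (spec_le X) A"
proof -
  have closed: "closedin X A" using A by (simp add: KF_def)
  then have AX: "A \<subseteq> topspace X" by (rule closedin_subset)
  have refl: "spec_le X x x" if "x \<in> A" for x
    using that AX by (intro spec_le_refl) auto
  have clA: "X closure_of A = A" using closed by (simp add: closure_of_eq)
  obtain \<K> where fil: "filtered_family X \<K>" and meets: "closed_meeting X \<K> A"
    and min: "\<forall>C. closed_meeting X \<K> C \<and> C \<subseteq> A \<longrightarrow> C = A"
    using A unfolding KF_def KF_set_def mem_Collect_eq clA by (elim conjE exE)
  have eq: "downset X (K \<inter> A) = A"
    if "K \<in> compact_saturated X" "\<And>L. L \<in> \<K> \<Longrightarrow> downset X (K \<inter> A) \<inter> L \<noteq> {}" for K
    using that cl by (intro min[rule_format] conjI downset_Int_closedin_subset[OF closed])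
      (simp add: closed_meeting_def)
  have below: "downset X (K \<inter> A) = A" if K: "K \<in> \<K>" for K
  proof (rule eq)
    show "K \<in> compact_saturated X" using K fil by (auto simp: filtered_family_def)
    fix L assume "L \<in> \<K>"
    then obtain N where N: "N \<in> \<K>" "N \<subseteq> K" "N \<subseteq> L"
      using fil K unfolding filtered_family_def by blast
    then obtain x where x: "x \<in> A" "x \<in> N" using meets unfolding closed_meeting_def by blast
    then have "x \<in> downset X (K \<inter> A)" using N AX refl[OF x(1)] by (auto simp: downset_def)
    then show "downset X (K \<inter> A) \<inter> L \<noteq> {}" using x N by blast
  qed
  have above: "downset X (upset X {m} \<inter> A) = A" if m: "m \<in> A" for m
  proof (rule eq)
    show "upset X {m} \<in> compact_saturated X"
      using m AX by (intro upset_compact_saturated finite_imp_compactin) auto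
    fix L assume "L \<in> \<K>"
    then have "m \<in> downset X (L \<inter> A)" using below m by simp
    then obtain x where x: "x \<in> L" "x \<in> A" "spec_le X m x" by (auto simp: downset_def)
    then have "x \<in> downset X (upset X {m} \<inter> A)"
      using AX refl[OF x(2)] by (auto simp: downset_def upset_def)
    then show "downset X (upset X {m} \<inter> A) \<inter> L \<noteq> {}" using x by blast
  qed
  show ?thesis
    unfolding directed_in_def
  proof (intro conjI ballI)
    show "A \<noteq> {}" using A by (simp add: KF_def KF_set_def)
    fix x y assume "x \<in> A" "y \<in> A"
    then have "x \<in> downset X (upset X {y} \<inter> A)" using above by simp
    then show "\<exists>z\<in>A. spec_le X x z \<and> spec_le X y z" by (auto simp: downset_def upset_def)
  qed simp
qed

lemma directed_closed_in_d_closure: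
  assumes closed: "closedin X A" and dir: "directed_in A (spec_le X) A"
  shows "A \<in> d_closure {C. closedin X C} (\<subseteq>) (point_closures X)"
proof -
  let ?P = "{C. closedin X C}"
  define \<D> where "\<D> = (\<lambda>a. X closure_of {a}) ` A"
  have AX: "A \<subseteq> topspace X" using closed by (rule closedin_subset)
  have le: "X closure_of {a} \<subseteq> X closure_of {b}" if "a \<in> A" "spec_le X a b" for a b
  proof -
    have "a \<in> topspace X" "a \<in> X closure_of {b}" using that AX by (auto simp: spec_le_def)
    then show ?thesis by (simp add: closure_of_singleton_subset_iff)
  qed
  have pc: "point_closures X \<subseteq> ?P" by (auto simp: point_closures_def)
  have D: "directed_in ?P (\<subseteq>) \<D>"
    unfolding directed_in_def
  proof (intro conjI ballI)
    show "\<D> \<subseteq> ?P" by (auto simp: \<D>_def)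
    show "\<D> \<noteq> {}" using dir by (auto simp: \<D>_def directed_in_def)
    fix B C assume "B \<in> \<D>" "C \<in> \<D>"
    then obtain b c where b: "b \<in> A" "B = X closure_of {b}" and c: "c \<in> A" "C = X closure_of {c}"
      by (auto simp: \<D>_def)
    then obtain a where "a \<in> A" "spec_le X b a" "spec_le X c a"
      using dir unfolding directed_in_def by blast
    then show "\<exists>E\<in>\<D>. B \<subseteq> E \<and> C \<subseteq> E"
      using b c le unfolding \<D>_def by blast
  qed
  have "\<Union>\<D> = A"
  proof
    show "\<Union>\<D> \<subseteq> A"
      unfolding \<D>_def using closed by (intro UN_least closure_of_minimal) auto
    show "A \<subseteq> \<Union>\<D>"
      using AX by (force simp: \<D>_def in_closure_of)
  qed
  moreover have "is_sup_in ?P (\<subseteq>) \<D> (X closure_of \<Union>\<D>)"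
    by (intro is_sup_in_closed) (auto simp: \<D>_def)
  ultimately have "is_sup_in ?P (\<subseteq>) \<D> A"
    using closed by (simp add: closure_of_closedin)
  moreover have "\<D> \<subseteq> d_closure ?P (\<subseteq>) (point_closures X)"
  proof -
    have "\<D> \<subseteq> point_closures X" using AX by (auto simp: \<D>_def point_closures_def)
    then show ?thesis unfolding d_closure_def by (meson hull_subset subset_trans)
  qed
  ultimately show ?thesis
    using d_closed_in_d_closure[OF pc] D unfolding d_closed_in_def by blast
qed

lemma WD_closure_of_singleton:
  assumes x: "x \<in> topspace X"
  shows "X closure_of {x} \<in> WD X"
  unfolding WD_def WD_set_def mem_Collect_eq
proof (intro conjI allI impI)
  fix Y :: "'a set topology" and f
  assume Y: "t0_space Y \<and> well_filtered Y \<and> continuous_map X Y f"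
  then have fx: "f x \<in> topspace Y" using x by (auto simp: continuous_map_def)
  have "f ` (X closure_of {x}) \<subseteq> Y closure_of {f x}"
    using Y continuous_map_image_closure_subset[of X Y f "{x}"] by simp
  moreover have "f x \<in> f ` (X closure_of {x})" using x by (auto simp: in_closure_of)
  ultimately have "Y closure_of (f ` (X closure_of {x})) = Y closure_of {f x}"
    by (intro subset_antisym closure_of_minimal closure_of_mono) auto
  then show "\<exists>!y. y \<in> topspace Y \<and> Y closure_of (f ` (X closure_of {x})) = Y closure_of {y}"
    using fx Y unfolding t0_space_closure_of_sing by (intro ex1I[of _ "f x"]) auto
qed (auto simp: closure_of_subset_topspace)

text \<open>
  If \<open>p A\<close> represents the image of \<open>A \<in> \<D>\<close> in the test space \<open>Y\<close>, the sets \<open>\<up>(p A)\<close> form a filtered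
  family of compact saturated sets, none of which lies in the complement of the closure of the
  image of \<open>\<Union>\<D>\<close>. Well-filteredness yields a point of that closure above all \<open>p A\<close>, and this point
  generates the closure.
\<close>

lemma WD_closure_of_Union:
  assumes sub: "\<D> \<subseteq> WD X" and dir: "directed_in (WD X) (\<subseteq>) \<D>"
  shows "X closure_of \<Union>\<D> \<in> WD X"
  unfolding WD_def WD_set_def mem_Collect_eq
proof (intro conjI allI impI)
  fix Y :: "'a set topology" and f
  assume Y: "t0_space Y \<and> well_filtered Y \<and> continuous_map X Y f"
  define S where "S = X closure_of \<Union>\<D>"
  have DX: "\<Union>\<D> \<subseteq> topspace X" using sub by (auto simp: WD_def WD_set_def)
  then have DS: "\<Union>\<D> \<subseteq> S" by (simp add: S_def closure_of_subset)
  have img: "f ` B \<subseteq> topspace Y" if "B \<subseteq> topspace X" for B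
    using Y that by (auto simp: continuous_map_def)
  have "\<forall>A\<in>\<D>. \<exists>y. y \<in> topspace Y \<and> Y closure_of (f ` A) = Y closure_of {y}"
    using sub Y unfolding WD_def WD_set_def by blast
  then obtain p where p: "\<And>A. A \<in> \<D> \<Longrightarrow> p A \<in> topspace Y"
    "\<And>A. A \<in> \<D> \<Longrightarrow> Y closure_of (f ` A) = Y closure_of {p A}"
    by metis
  have p_mono: "upset Y {p B} \<subseteq> upset Y {p A}" if AB: "A \<in> \<D>" "B \<in> \<D>" "A \<subseteq> B" for A B
  proof -
    have "Y closure_of {p A} \<subseteq> Y closure_of {p B}"
      using p(2) AB closure_of_mono[of "f ` A" "f ` B" Y] by (metis image_mono)
    then have "spec_le Y (p A) (p B)"
      using p(1) AB by (auto simp: spec_le_def closure_of_singleton_subset_iff)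
    then show ?thesis using spec_le_trans[of Y "p A" "p B"] by (auto simp: upset_def)
  qed
  have pS: "p A \<in> Y closure_of (f ` S)" if A: "A \<in> \<D>" for A
  proof -
    have "Y closure_of {p A} \<subseteq> Y closure_of (f ` S)"
      unfolding p(2)[OF A, symmetric] using A DS by (intro closure_of_mono) blast
    then show ?thesis using p(1)[OF A] by (simp add: closure_of_singleton_subset_iff)
  qed
  let ?\<K> = "(\<lambda>A. upset Y {p A}) ` \<D>" and ?U = "topspace Y - Y closure_of (f ` S)"
  have "filtered_family Y ?\<K>"
    unfolding filtered_family_def
  proof (intro conjI ballI)
    show "?\<K> \<subseteq> compact_saturated Y"
      using p(1) by (auto intro!: upset_compact_saturated finite_imp_compactin)
    show "?\<K> \<noteq> {}" using dir by (auto simp: directed_in_def)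
    fix K L assume "K \<in> ?\<K>" "L \<in> ?\<K>"
    then obtain A B where AB: "A \<in> \<D>" "B \<in> \<D>" "K = upset Y {p A}" "L = upset Y {p B}"
      by blast
    then obtain C where C: "C \<in> \<D>" "A \<subseteq> C" "B \<subseteq> C"
      using dir unfolding directed_in_def by blast
    then have "upset Y {p C} \<subseteq> K" "upset Y {p C} \<subseteq> L" using AB p_mono by simp_all
    then show "\<exists>M\<in>?\<K>. M \<subseteq> K \<and> M \<subseteq> L" using C(1) by blast
  qed
  moreover have "\<not> K \<subseteq> ?U" if "K \<in> ?\<K>" for K
  proof -
    obtain A where A: "A \<in> \<D>" "K = upset Y {p A}" using \<open>K \<in> ?\<K>\<close> by blast
    then have "p A \<in> K" using p(1) upset_subset[of "{p A}" Y] by simp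
    then show ?thesis using pS[OF A(1)] by blast
  qed
  moreover have "openin Y ?U" by auto
  ultimately have "\<not> \<Inter>?\<K> \<subseteq> ?U"
    using Y unfolding well_filtered_def by blast
  then obtain y where y: "\<And>A. A \<in> \<D> \<Longrightarrow> y \<in> upset Y {p A}" and "y \<notin> ?U" by blast
  moreover obtain A0 where "A0 \<in> \<D>" using dir by (auto simp: directed_in_def)
  ultimately have yY: "y \<in> topspace Y" and yS: "y \<in> Y closure_of (f ` S)"
    by (auto simp: upset_def)
  have "f ` \<Union>\<D> \<subseteq> Y closure_of {y}"
  proof
    fix z assume "z \<in> f ` \<Union>\<D>"
    then obtain A where A: "A \<in> \<D>" "z \<in> f ` A" by blast
    then have "f ` A \<subseteq> Y closure_of (f ` A)"
      using DX by (intro closure_of_subset img) blast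
    then have "z \<in> Y closure_of {p A}" using A p(2) by blast
    moreover have "Y closure_of {p A} \<subseteq> Y closure_of {y}"
      using y[OF A(1)] p(1)[OF A(1)]
      by (simp add: upset_def spec_le_def closure_of_singleton_subset_iff)
    ultimately show "z \<in> Y closure_of {y}" by blast
  qed
  then have "Y closure_of (f ` \<Union>\<D>) \<subseteq> Y closure_of {y}" by (simp add: closure_of_minimal)
  then have "f ` S \<subseteq> Y closure_of {y}"
    using Y continuous_map_image_closure_subset[of X Y f "\<Union>\<D>"] unfolding S_def by blast
  then have "Y closure_of (f ` S) = Y closure_of {y}"
    using yS by (intro subset_antisym closure_of_minimal) auto
  then show "\<exists>!y. y \<in> topspace Y \<and> Y closure_of (f ` (X closure_of \<Union>\<D>)) = Y closure_of {y}"
    using yY Y unfolding t0_space_closure_of_sing S_def by (intro ex1I[of _ y]) auto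
qed (auto simp: closure_of_subset_topspace)

lemma d_closure_point_closures_subset_WD:
  "d_closure {C. closedin X C} (\<subseteq>) (point_closures X) \<subseteq> WD X"
  unfolding d_closure_def
proof (rule hull_minimal)
  show "point_closures X \<subseteq> WD X"
    using WD_closure_of_singleton by (auto simp: point_closures_def)
  show "d_closed_in {C. closedin X C} (\<subseteq>) (WD X)"
    unfolding d_closed_in_def
  proof (intro conjI allI impI)
    show "WD X \<subseteq> {C. closedin X C}" by (auto simp: WD_def)
    fix \<D> S
    assume *: "directed_in {C. closedin X C} (\<subseteq>) \<D> \<and> \<D> \<subseteq> WD X \<and>
      is_sup_in {C. closedin X C} (\<subseteq>) \<D> S"
    then have "is_sup_in {C. closedin X C} (\<subseteq>) \<D> (X closure_of \<Union>\<D>)"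
      by (intro is_sup_in_closed) (auto simp: directed_in_def)
    with * have "S = X closure_of \<Union>\<D>"
      unfolding is_sup_in_def by (meson subset_antisym)
    moreover have "directed_in (WD X) (\<subseteq>) \<D>"
      using * by (simp add: directed_in_def)
    ultimately show "S \<in> WD X" using * WD_closure_of_Union by blast
  qed
qed

theorem theorem3p3:
  fixes X :: "'a topology"
  assumes "t0_space X"
    and "\<And>A K. A \<in> KF X \<Longrightarrow> K \<in> compact_saturated X \<Longrightarrow> closedin X (downset X (K \<inter> A))"
    and "lower_vietoris X (KF X) = well_filterification X"
  shows "D_completion X = well_filterification X"
proof -
  have "WD X = KF X"
    using assms(3) by (simp add: well_filterification_def lower_vietoris_eq_iff)
  moreover have "KF X \<subseteq> d_closure {C. closedin X C} (\<subseteq>) (point_closures X)"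
  proof
    fix A assume A: "A \<in> KF X"
    then have "closedin X A" by (simp add: KF_def)
    moreover have "directed_in A (spec_le X) A" using A assms(2) by (intro directed_in_KF)
    ultimately show "A \<in> d_closure {C. closedin X C} (\<subseteq>) (point_closures X)"
      by (rule directed_closed_in_d_closure)
  qed
  ultimately have "d_closure {C. closedin X C} (\<subseteq>) (point_closures X) = WD X"
    using d_closure_point_closures_subset_WD[of X] by blast
  then show ?thesis by (simp add: D_completion_def well_filterification_def)
qed

end
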